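(* Let $\mathcal A$ be an alphabet containing at least two letters and let $v\in\mathcal A^*$. The epistandard morphism $\mu_v$ is strongly quasiperiodic on $\mathcal A$ if and only if $\mathrm{Alph}(v)=\mathcal A$. Moreover, when $\mathrm{Alph}(v)=\mathcal A$, $Pal(v)$ is a quasiperiod of $\mu_v(\mathbf w)$ for every infinite word $\mathbf w$ over $\mathcal A$.
   Context: $\mathrm{Alph}(u)$ is the set of letters of $u$. For $a\in\mathcal A$, $L_a$ is the morphism with $L_a(a)=a$, $L_a(b)=ab$ for $b\ne a$; for $v=x_1\cdots x_n$, $\mu_v=L_{x_1}\circ\cdots\circ L_{x_n}$ ($\mu_\varepsilon$ the identity), extended letterwise to infinite words. $Pal$: $Pal(\varepsilon)=\varepsilon$, $Pal(ux)$ is the shortest palindrome having $Pal(u)x$ as a prefix. A finite word $u$ is a quasiperiod of an infinite word $\mathbf w$ if there are words $p_n$ ($n\ge0$) with $p_0=\varepsilon$, $|p_n|<|p_{n+1}|\le|p_nu|$ and $p_nu$ a prefix of $\mathbf w$; $\mathbf w$ is quasiperiodic if it has a quasiperiod. A morphism $f$ on $\mathcal A$ is strongly quasiperiodic if $f(\mathbf w)$ is quasiperiodic for every infinite word $\mathbf w$ over $\mathcal A$. *)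

theory Defs
  imports "HOL-Library.Stream" "HOL-Library.Sublist"
begin

definition L :: "'a \<Rightarrow> 'a list \<Rightarrow> 'a list" where
  "L a u = concat (map (\<lambda>b. if b = a then [a] else [a, b]) u)"

primrec mu :: "'a list \<Rightarrow> 'a list \<Rightarrow> 'a list" where
  "mu [] = id"
| "mu (x # v) = L x \<circ> mu v"

text \<open>Letterwise extension of a morphism to infinite words. As \<^const>\<open>flat\<close> is
  meaningful only for streams of nonempty lists, this is the usual extension only when
  no letter of the word is erased.\<close>

definition inf_image :: "('a list \<Rightarrow> 'b list) \<Rightarrow> 'a stream \<Rightarrow> 'b stream" where
  "inf_image f w = flat (smap (\<lambda>a. f [a]) w)"

text \<open>The shortest palindrome with prefix \<open>w\<close> is unique: its length is at most twice that of
  \<open>w\<close>, and a palindrome of such a length is determined by its length and its prefix \<open>w\<close>.\<close>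

definition pal_closure :: "'a list \<Rightarrow> 'a list" where
  "pal_closure w = (ARG_MIN length p. rev p = p \<and> prefix w p)"

definition Pal :: "'a list \<Rightarrow> 'a list" where
  "Pal v = foldl (\<lambda>p x. pal_closure (p @ [x])) [] v"

definition inf_prefix :: "'a list \<Rightarrow> 'a stream \<Rightarrow> bool" where
  "inf_prefix u w \<longleftrightarrow> (\<exists>w'. w = u @- w')"

definition quasiperiod :: "'a list \<Rightarrow> 'a stream \<Rightarrow> bool" where
  "quasiperiod u w \<longleftrightarrow>
     (\<exists>p :: nat \<Rightarrow> 'a list. p 0 = [] \<and>
        (\<forall>n. length (p n) < length (p (Suc n)) \<and>
             length (p (Suc n)) \<le> length (p n @ u) \<and>
             inf_prefix (p n @ u) w))"

definition quasiperiodic :: "'a stream \<Rightarrow> bool" where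
  "quasiperiodic w \<longleftrightarrow> (\<exists>u. quasiperiod u w)"

text \<open>The first conjunct keeps \<^const>\<open>inf_image\<close> within its intended domain and loses nothing:
  a morphism erasing a letter \<open>a\<close> maps the infinite word \<open>aaa...\<close> to the empty word, which is
  not a quasiperiodic infinite word.\<close>

definition strongly_quasiperiodic :: "'a set \<Rightarrow> ('a list \<Rightarrow> 'b list) \<Rightarrow> bool" where
  "strongly_quasiperiodic A f \<longleftrightarrow>
     (\<forall>a\<in>A. f [a] \<noteq> []) \<and> (\<forall>w\<in>streams A. quasiperiodic (inf_image f w))"

end

theory Submission
  imports Defs "HOL-Library.Multiset"
begin

text \<open>Justin's formula \<open>Pal (x v) = L\<^sub>x (Pal v) x\<close> turns \<open>Pal\<close> into a recursion on the first letter.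
  It follows from the fact that a palindrome starting with \<open>L\<^sub>y (u) y x\<close>, if it is short enough,
  has \<open>y\<close> in each pair of consecutive letters and hence is \<open>L\<^sub>y (q) y\<close> for a palindrome \<open>q\<close>
  starting with \<open>u x\<close>.

  By that recursion \<open>Pal v\<close> is a prefix of every \<open>\<mu>\<^sub>v (w)\<close>, and \<open>\<mu>\<^sub>v (a)\<close> is a prefix of
  \<open>Pal v\<close> for each letter \<open>a\<close> of \<open>v\<close>. So if all letters occur in \<open>v\<close>, the occurrences of
  \<open>Pal v\<close> at the block boundaries of \<open>\<mu>\<^sub>v (w)\<close> cover it. If a letter \<open>a\<close> does not occur in
  \<open>v\<close>, choose \<open>b \<noteq> a\<close>: the word \<open>\<mu>\<^sub>v (a b b b ...)\<close> contains \<open>a\<close>, but only finitely often,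
  whereas a quasiperiod would have to contain \<open>a\<close> and to occur infinitely often.\<close>

section \<open>The morphisms\<close>

lemma L_Nil [simp]: "L y [] = []"
  by (simp add: L_def)

lemma L_Cons: "L y (b # u) = (if b = y then [y] else [y, b]) @ L y u"
  by (simp add: L_def)

lemma L_append [simp]: "L y (u @ w) = L y u @ L y w"
  by (simp add: L_def)

lemma L_snoc_starts: "\<exists>t. L y u @ [y] = y # t"
  by (cases u) (auto simp: L_Cons)

text \<open>With the closing \<open>y\<close>, every letter other than \<open>y\<close> stands
  between two \<open>y\<close>s, so the coding reads alike from both ends.\<close>

lemma rev_L_snoc: "rev (L y u @ [y]) = L y (rev u) @ [y]"
proof (induction u)
  case (Cons b u)
  then show ?case
    by (cases "b = y") (auto simp: L_Cons)
qed simp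

lemma mset_L: "mset (L y u) = replicate_mset (length u) y + filter_mset (\<lambda>b. b \<noteq> y) (mset u)"
  by (induction u) (auto simp: L_Cons)

lemma mset_L_mono:
  assumes "mset u \<subseteq># mset w"
  shows "mset (L y u) \<subseteq># mset (L y w)"
proof -
  have "length u \<le> length w"
    using size_mset_mono[OF assms] by simp
  then have "replicate_mset (length u) y \<subseteq># replicate_mset (length w) y"
    by (simp add: subseteq_mset_def)
  then show ?thesis
    unfolding mset_L by (intro subset_mset.add_mono multiset_filter_mono assms)
qed

text \<open>Decoding from the left: a \<open>y\<close> before another \<open>y\<close> encodes
  \<open>y\<close>, and \<open>y b\<close> with \<open>b \<noteq> y\<close> encodes
  \<open>b\<close>. The letter \<open>x\<close> resolves the last \<open>y\<close>.\<close>

lemma prefix_L_snoc2_imp_prefix: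
  assumes "prefix (L y u @ [y, x]) (L y q @ [y])"
  shows "prefix (u @ [x]) q"
  using assms
proof (induction u arbitrary: q)
  case Nil
  then obtain c t where q: "q = c # t"
    by (cases q) auto
  with Nil L_snoc_starts[of y t] show ?case
    by (auto simp: L_Cons split: if_splits)
next
  case (Cons a u)
  then obtain c t where q: "q = c # t"
    by (cases q) (auto simp: L_Cons split: if_splits)
  obtain t1 where t1: "L y t @ [y] = y # t1"
    using L_snoc_starts[of y t] by blast
  obtain t2 where "L y u @ [y] = y # t2"
    using L_snoc_starts[of y u] by blast
  then have t2: "L y u @ [y, x] = y # t2 @ [x]"
    by (metis append.assoc append_Cons append_Nil)
  have "a = c \<and> prefix (L y u @ [y, x]) (L y t @ [y])"
    using Cons.prems unfolding q L_Cons append_assoc t1 t2 by (auto split: if_splits)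
  with Cons.IH show ?case
    by (simp add: q)
qed

lemma L_snoc_inject:
  assumes "L y u @ [y] = L y w @ [y]"
  shows "u = w"
proof -
  have "prefix u' w'" if "L y u' @ [y] = L y w' @ [y]" for u' w'
  proof (cases u' rule: rev_cases)
    case (snoc u'' a)
    \<comment> \<open>The two words are equal if \<open>a = y\<close>; otherwise the left one is
      \<open>L y u'\<close>.\<close>
    then have "prefix (L y u'' @ [y, a]) (L y w' @ [y])"
      using that by (cases "a = y") (auto simp flip: that simp: L_Cons)
    then show ?thesis
      using prefix_L_snoc2_imp_prefix snoc by metis
  qed simp
  then show ?thesis
    using assms by (metis prefix_order.antisym)
qed

lemma successively_L_snoc: "successively (\<lambda>a b. a = y \<or> b = y) (L y u @ [y])"
proof (induction u)
  case (Cons b u)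
  then show ?case
    using L_snoc_starts[of y u] by (auto simp: L_Cons)
qed simp

text \<open>Peel off \<open>y\<close> if another \<open>y\<close> follows, otherwise
  \<open>y b\<close>; the pair condition then puts a \<open>y\<close> after
  \<open>b\<close>.\<close>

lemma L_snoc_decode:
  assumes "successively (\<lambda>a b. a = y \<or> b = y) q" "q \<noteq> []" "hd q = y" "last q = y"
  shows "\<exists>q'. q = L y q' @ [y]"
  using assms
proof (induction q rule: length_induct)
  case (1 q)
  show ?case
  proof (cases "tl q")
    case Nil
    then have "q = L y [] @ [y]"
      using "1.prems" by (cases q) auto
    then show ?thesis by blast
  next
    case (Cons b t)
    then have q: "q = y # b # t"
      using "1.prems" by (cases q) auto
    show ?thesis
    proof (cases "b = y")
      case True
      then have "\<exists>q'. b # t = L y q' @ [y]"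
        using "1.prems" q by (intro "1.IH"[rule_format]) auto
      then obtain q' where "b # t = L y q' @ [y]" by blast
      then have "q = L y (y # q') @ [y]"
        using q by (simp add: L_Cons)
      then show ?thesis by blast
    next
      case False
      then have "t \<noteq> []"
        using "1.prems"(4) q by auto
      then have "\<exists>q'. t = L y q' @ [y]"
        using "1.prems" q False by (intro "1.IH"[rule_format]) (auto simp: successively_Cons)
      then obtain q' where "t = L y q' @ [y]" by blast
      then have "q = L y (b # q') @ [y]"
        using q False by (simp add: L_Cons)
      then show ?thesis by blast
    qed
  qed
qed

lemma mu_Nil_right [simp]: "mu v [] = []"
  by (induction v) auto

lemma mu_append [simp]: "mu v (u @ w) = mu v u @ mu v w"
  by (induction v) auto

lemma length_L_ge: "length u \<le> length (L y u)"
  by (induction u) (auto simp: L_Cons)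

lemma length_mu_ge: "length u \<le> length (mu v u)"
proof (induction v)
  case (Cons x v)
  then show ?case
    using length_L_ge[of "mu v u" x] by simp
qed simp

lemma mu_eq_Nil_iff [simp]: "mu v u = [] \<longleftrightarrow> u = []"
  using length_mu_ge[of u v] by auto

lemma set_L: "set u \<subseteq> set (L y u)" "set (L y u) \<subseteq> insert y (set u)"
  by (induction u) (auto simp: L_Cons)

lemma set_mu: "set u \<subseteq> set (mu v u)" "set (mu v u) \<subseteq> set v \<union> set u"
proof (induction v)
  case (Cons x v)
  {
    case 1
    show ?case using Cons(1) set_L(1)[of "mu v u" x] by auto
  next
    case 2
    show ?case using Cons(2) set_L(2)[of x "mu v u"] by auto
  }
qed simp_all

section \<open>Justin's formula\<close>

text \<open>Recursion on the first letter, where \<open>Pal\<close> recurses on the last;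
  \<open>Pal_eq_justin_pal\<close> identifies the two.\<close>

primrec justin_pal :: "'a list \<Rightarrow> 'a list" where
  "justin_pal [] = []"
| "justin_pal (x # v) = L x (justin_pal v) @ [x]"

lemma rev_justin_pal: "rev (justin_pal v) = justin_pal v"
  by (induction v) (simp_all only: justin_pal.simps rev_L_snoc rev.simps)

text \<open>For \<open>v = [x]\<close> this reads
  \<open>justin_pal (u @ [x]) = mu u [x] @ justin_pal u\<close>, the form used for lengths and
  letter counts.\<close>

lemma justin_pal_append: "justin_pal (u @ v) = mu u (justin_pal v) @ justin_pal u"
  by (induction u) auto

lemma prefix_justin_pal_snoc: "prefix (justin_pal v @ [x]) (justin_pal (v @ [x]))"
proof (induction v)
  case (Cons y v)
  then obtain s where s: "justin_pal (v @ [x]) = justin_pal v @ x # s"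
    by (auto simp: prefix_def)
  obtain t where "L y s @ [y] = y # t"
    using L_snoc_starts[of y s] by blast
  \<comment> \<open>For \<open>x = y\<close> the wanted \<open>x\<close> is the \<open>y\<close>
    that opens \<open>L y s @ [y]\<close>; otherwise it ends the block
    \<open>[y, x]\<close>.\<close>
  then have "justin_pal ((y # v) @ [x]) = justin_pal (y # v) @ x # (if x = y then t else L y s @ [y])"
    by (auto simp: s L_Cons)
  then show ?case
    by (simp del: justin_pal.simps)
qed simp

text \<open>The appended \<open>justin_pal v\<close> admits short \<open>u\<close>; once
  \<open>mu v u\<close> is as long as \<open>justin_pal v\<close>, it begins with
  \<open>justin_pal v\<close>.\<close>

lemma prefix_justin_pal_mu: "prefix (justin_pal v) (mu v u @ justin_pal v)"
proof (induction v)
  case (Cons x v)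
  then obtain s where "mu v u @ justin_pal v = justin_pal v @ s"
    by (auto simp: prefix_def)
  then have "L x (mu v u) @ L x (justin_pal v) = L x (justin_pal v) @ L x s"
    by (metis L_append)
  then have "mu (x # v) u @ justin_pal (x # v) = L x (justin_pal v) @ L x s @ [x]"
    by simp
  moreover obtain t where "L x s @ [x] = x # t"
    using L_snoc_starts[of x s] by blast
  ultimately have "mu (x # v) u @ justin_pal (x # v) = justin_pal (x # v) @ t"
    by simp
  then show ?case
    by (rule prefixI)
qed simp

lemma mu_fresh_letter: "a \<notin> set v \<Longrightarrow> mu v [a] = justin_pal v @ [a]"
  by (induction v) (auto simp: L_Cons)

lemma prefix_mu_letter:
  assumes "a \<in> set v"
  shows "prefix (mu v [a]) (justin_pal v)"
  using assms
proof (induction v)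
  case (Cons x v)
  show ?case
  proof (cases "a \<in> set v")
    case True
    then obtain s where "justin_pal v = mu v [a] @ s"
      using Cons.IH by (auto simp: prefix_def)
    then show ?thesis by simp
  next
    case False
    \<comment> \<open>Here \<open>a = x\<close>, and the two words are equal since
      \<open>mu v [x] = justin_pal v @ [x]\<close>.\<close>
    then show ?thesis
      using Cons.prems by (simp add: mu_fresh_letter L_Cons)
  qed
qed simp

lemma prefix_mu_letter_snoc: "prefix (mu v [x]) (justin_pal v @ [x])"
  using prefix_mu_letter[of x v] mu_fresh_letter[of x v]
  by (cases "x \<in> set v") (auto intro: prefix_prefix)

lemma length_justin_pal_snoc_le:
  "length (justin_pal (v @ [x])) \<le> 2 * length (justin_pal v) + 1"
  using prefix_length_le[OF prefix_mu_letter_snoc[of v x]] by (simp add: justin_pal_append)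

section \<open>Palindromes with a prescribed prefix, and minimality of
  \<open>justin_pal\<close>\<close>

lemma palindrome_nth:
  assumes "rev q = q" "i < length q"
  shows "q ! i = q ! (length q - Suc i)"
  using assms by (metis rev_nth)

text \<open>Every position beyond \<open>w\<close> mirrors into \<open>w\<close>, which covers at
  least half of the palindrome.\<close>

lemma palindrome_short_unique:
  assumes "rev p = p" "rev q = q" "prefix w p" "prefix w q"
    and "length p = length q" "length q \<le> 2 * length w"
  shows "p = q"
proof (rule nth_equalityI)
  fix i assume i: "i < length p"
  have same: "p ! j = q ! j" if "j < length w" for j
    using assms(3,4) that by (auto simp: prefix_def nth_append)
  show "p ! i = q ! i"
  proof (cases "i < length w")
    case False
    then have "length p - Suc i < length w"
      using i assms(5,6) by linarith
    then show ?thesis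
      using same palindrome_nth[OF assms(1) i] palindrome_nth[OF assms(2), of i] i assms(5) by simp
  qed (rule same)
qed (rule assms)

text \<open>A pair reaching beyond \<open>w\<close> mirrors to a pair inside \<open>w\<close>. The
  bound is strict because the middle pair of \<open>w @ rev w\<close> lies in neither half.\<close>

lemma palindrome_short_successively:
  assumes "rev q = q" "prefix w q" "length q < 2 * length w"
    and "successively R w" and "\<And>a b. R a b \<Longrightarrow> R b a"
  shows "successively R q"
  unfolding successively_conv_nth
proof (intro allI impI)
  fix i assume i: "Suc i < length q"
  have same: "q ! j = w ! j" if "j < length w" for j
    using assms(2) that by (auto simp: prefix_def nth_append)
  have R: "R (q ! j) (q ! Suc j)" if "Suc j < length w" for j
    using assms(4) that same by (simp add: successively_conv_nth)
  show "R (q ! i) (q ! Suc i)"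
  proof (cases "Suc i < length w")
    case False
    define j where "j = length q - Suc (Suc i)"
    have "Suc j = length q - Suc i" "Suc j < length w"
      using False i assms(3) by (auto simp: j_def)
    then show ?thesis
      using R[of j] palindrome_nth[OF assms(1), of i] palindrome_nth[OF assms(1), of "Suc i"] i assms(5)
      by (simp add: j_def)
  qed (rule R)
qed

text \<open>The prefix \<open>w\<close> and the suffix \<open>rev w\<close> do not overlap.\<close>

lemma palindrome_long_mset:
  assumes "rev q = q" "prefix w q" "2 * length w \<le> length q"
  shows "mset w + mset w \<subseteq># mset q"
proof -
  obtain t where t: "q = w @ t"
    using assms(2) by (auto simp: prefix_def)
  then have "rev t @ rev w = w @ t"
    using assms(1) by simp
  then have "suffix (rev w) (w @ t)"
    by (metis suffixI)
  then have "suffix (rev w) t"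
    using assms(3) t by (metis length_append length_rev mult_2 nat_add_left_cancel_le suffixI suffix_length_suffix)
  then show ?thesis
    using t by (auto simp: suffix_def)
qed

text \<open>The statement is about letter counts, not lengths, because \<open>length u \<le> length w\<close> does not
  give \<open>length (L y u) \<le> length (L y w)\<close>.\<close>

lemma mset_justin_pal_minimal:
  assumes "rev q = q" "prefix (justin_pal v @ [x]) q"
  shows "mset (justin_pal (v @ [x])) \<subseteq># mset q"
  using assms
proof (induction v arbitrary: q)
  case Nil
  then show ?case by (auto simp: prefix_def)
next
  case (Cons y v)
  let ?w = "justin_pal (y # v) @ [x]"
  show ?case
  proof (cases "2 * length ?w \<le> length q")
    case True
    \<comment> \<open>A long \<open>q\<close> counts the letters of \<open>?w\<close> twice, and
      \<open>justin_pal ((y # v) @ [x])\<close> splits into two words, each a prefix of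
      \<open>?w\<close>.\<close>
    obtain s where "?w = mu (y # v) [x] @ s"
      using prefix_mu_letter_snoc[of "y # v" x] unfolding prefix_def by blast
    then have "mset (mu (y # v) [x]) \<subseteq># mset ?w"
      by (simp only: mset_append mset_subset_eq_add_left)
    moreover have "mset (justin_pal (y # v)) \<subseteq># mset ?w"
      by simp
    ultimately have "mset (mu (y # v) [x]) + mset (justin_pal (y # v)) \<subseteq># mset ?w + mset ?w"
      by (rule subset_mset.add_mono)
    also have "\<dots> \<subseteq># mset q"
      using palindrome_long_mset[OF Cons.prems True] .
    finally show ?thesis
      by (simp add: justin_pal_append)
  next
    case False
    obtain t where t: "L y (justin_pal v) @ [y] = y # t"
      using L_snoc_starts[of y "justin_pal v"] by blast
    have "successively (\<lambda>a b. a = y \<or> b = y) ?w"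
      using successively_L_snoc[of y "justin_pal v"] by (simp add: successively_append_iff)
    then have "successively (\<lambda>a b. a = y \<or> b = y) q"
      using palindrome_short_successively[OF Cons.prems] False by auto
    moreover have "q \<noteq> []" "hd q = y"
      using Cons.prems(2) t by (auto simp: prefix_def)
    moreover have "last q = y"
      using \<open>hd q = y\<close> \<open>q \<noteq> []\<close> Cons.prems(1) by (metis hd_rev)
    ultimately obtain q' where q': "q = L y q' @ [y]"
      using L_snoc_decode[of y q] by blast
    have "L y (rev q') @ [y] = L y q' @ [y]"
      using Cons.prems(1) unfolding q' rev_L_snoc .
    then have "rev q' = q'"
      by (rule L_snoc_inject)
    moreover have "prefix (justin_pal v @ [x]) q'"
      using Cons.prems(2) q' by (intro prefix_L_snoc2_imp_prefix[of y]) simp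
    ultimately have "mset (justin_pal (v @ [x])) \<subseteq># mset q'"
      by (rule Cons.IH)
    then show ?thesis
      using mset_L_mono[of _ q' y] q' by simp
  qed
qed

text \<open>Comparing letter counts bounds the length of every candidate from below, so the minimum
  has the length of \<open>justin_pal (v @ [x])\<close>; this length is small enough for
  uniqueness.\<close>

lemma pal_closure_justin_pal: "pal_closure (justin_pal v @ [x]) = justin_pal (v @ [x])"
proof -
  let ?w = "justin_pal v @ [x]"
  let ?P = "\<lambda>p. rev p = p \<and> prefix ?w p"
  let ?q = "pal_closure ?w"
  have P: "?P (justin_pal (v @ [x]))"
    by (intro conjI rev_justin_pal prefix_justin_pal_snoc)
  have q: "?P ?q" "length ?q \<le> length (justin_pal (v @ [x]))"
    using arg_min_nat_lemma[of ?P, OF P, of length] P unfolding pal_closure_def by blast+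
  have "length (justin_pal (v @ [x])) \<le> length ?q"
    using size_mset_mono[OF mset_justin_pal_minimal[of ?q v x]] q(1) by simp
  then have "length ?q = length (justin_pal (v @ [x]))"
    using q(2) by simp
  moreover have "length (justin_pal (v @ [x])) \<le> 2 * length ?w"
    using length_justin_pal_snoc_le[of v x] by simp
  ultimately show ?thesis
    using palindrome_short_unique P q(1) by blast
qed

lemma Pal_eq_justin_pal: "Pal v = justin_pal v"
proof (induction v rule: rev_induct)
  case (snoc x v)
  then show ?case
    by (simp add: Pal_def pal_closure_justin_pal)
qed (simp add: Pal_def)

section \<open>Quasiperiodicity\<close>

lemma inf_image_mu_unfold:
  "inf_image (mu v) w = mu v (stake n w) @- inf_image (mu v) (sdrop n w)"
proof (induction n arbitrary: w)
  case (Suc n)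
  have "inf_image (mu v) w = mu v [shd w] @- inf_image (mu v) (stl w)"
    unfolding inf_image_def by (subst flat_unfold) simp_all
  also have "\<dots> = mu v ([shd w] @ stake n (stl w)) @- inf_image (mu v) (sdrop n (stl w))"
    using Suc[of "stl w"] by (simp only: mu_append shift_append)
  finally show ?case by simp
qed simp

lemma inf_prefix_justin_pal: "inf_prefix (justin_pal v) (inf_image (mu v) w)"
proof -
  \<comment> \<open>\<open>mu v\<close> never shortens a word, so the image of this many letters is
    long enough.\<close>
  let ?u = "stake (length (justin_pal v)) w"
  have "length (justin_pal v) \<le> length (mu v ?u)"
    using length_mu_ge[of ?u v] by simp
  then have "prefix (justin_pal v) (mu v ?u)"
    using prefix_justin_pal_mu[of v ?u] by (metis prefix_length_prefix prefixI)
  then obtain s where "mu v ?u = justin_pal v @ s"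
    by (auto simp: prefix_def)
  then show ?thesis
    unfolding inf_prefix_def by (metis inf_image_mu_unfold shift_append)
qed

lemma quasiperiod_Pal:
  assumes "w \<in> streams (set v)"
  shows "quasiperiod (Pal v) (inf_image (mu v) w)"
  unfolding quasiperiod_def
proof (intro exI[of _ "\<lambda>n. mu v (stake n w)"] conjI allI)
  fix n
  have step: "mu v (stake (Suc n) w) = mu v (stake n w) @ mu v [w !! n]"
    by (simp only: stake_Suc mu_append)
  show "length (mu v (stake n w)) < length (mu v (stake (Suc n) w))"
    unfolding step by simp
  have "w !! n \<in> set v"
    using assms by (simp add: streams_iff_snth)
  then show "length (mu v (stake (Suc n) w)) \<le> length (mu v (stake n w) @ Pal v)"
    unfolding step Pal_eq_justin_pal using prefix_length_le[OF prefix_mu_letter] by simp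
  obtain w' where "inf_image (mu v) (sdrop n w) = justin_pal v @- w'"
    using inf_prefix_justin_pal unfolding inf_prefix_def by blast
  then show "inf_prefix (mu v (stake n w) @ Pal v) (inf_image (mu v) w)"
    unfolding inf_prefix_def Pal_eq_justin_pal by (metis inf_image_mu_unfold shift_append)
qed simp

text \<open>The letter lies in some occurrence of the quasiperiod \<open>u\<close>, hence at the
  same offset in the occurrence after \<open>p N\<close>, which starts at or beyond position
  \<open>N\<close>.\<close>

lemma quasiperiodic_recurrent:
  assumes "quasiperiodic w" "a \<in> sset w"
  shows "a \<in> sset (sdrop N w)"
proof -
  obtain u p where p0: "p 0 = []"
    and lt: "\<And>n. length (p n) < length (p (Suc n))"
    and le: "\<And>n. length (p (Suc n)) \<le> length (p n @ u)"
    and pre: "\<And>n. inf_prefix (p n @ u) w"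
    using assms(1) unfolding quasiperiodic_def quasiperiod_def by blast
  have ge: "n \<le> length (p n)" for n
    by (induction n) (use lt in \<open>auto intro: Suc_leI le_less_trans\<close>)
  have occ: "w !! (length (p n) + j) = u ! j" if "j < length u" for n j
    using pre[of n] that by (auto simp: inf_prefix_def)
  obtain k where k: "w !! k = a"
    using assms(2) by (auto simp: sset_range)
  \<comment> \<open>The starts increase strictly from 0, so \<open>k\<close> falls between two
    successive ones; the bound on gaps puts it inside the occurrence after
    \<open>p n\<close>.\<close>
  obtain n where n: "length (p n) \<le> k" "k < length (p (Suc n))"
    using ex_least_nat_less[of "\<lambda>n. k < length (p n)" "Suc k"] p0 ge[of "Suc k"]
    by (auto simp: not_less)
  then have j: "k - length (p n) < length u"
    using le[of n] by simp
  then have "a = w !! (length (p N) + (k - length (p n)))"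
    using occ[OF j, of n] occ[OF j, of N] n(1) k by simp
  also have "\<dots> = sdrop N w !! (length (p N) - N + (k - length (p n)))"
    using ge[of N] by (simp add: sdrop_snth)
  finally show ?thesis
    by (metis snth_sset)
qed

lemma sset_inf_image_mu: "sset (inf_image (mu v) w) \<subseteq> set v \<union> sset w"
proof -
  have "sset (inf_image (mu v) w) = (\<Union>a\<in>sset w. set (mu v [a]))"
    unfolding inf_image_def by (subst sset_flat) (auto simp: stream.set_map)
  then show ?thesis
    using set_mu(2) by fastforce
qed

theorem theorem5p1:
  fixes A :: "'a set" and v :: "'a list"
  assumes "finite A" and "2 \<le> card A" and "v \<in> lists A"
  shows "(strongly_quasiperiodic A (mu v) \<longleftrightarrow> set v = A) \<and>
         (set v = A \<longrightarrow> (\<forall>w\<in>streams A. quasiperiod (Pal v) (inf_image (mu v) w)))"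
proof -
  have Pal: "quasiperiod (Pal v) (inf_image (mu v) w)" if "set v = A" "w \<in> streams A" for w
    using quasiperiod_Pal that by blast
  then have "strongly_quasiperiodic A (mu v)" if "set v = A"
    using that unfolding strongly_quasiperiodic_def quasiperiodic_def by auto
  moreover have "set v = A" if sq: "strongly_quasiperiodic A (mu v)"
  proof (rule ccontr)
    assume "set v \<noteq> A"
    then obtain a where a: "a \<in> A" "a \<notin> set v"
      using assms(3) by auto
    obtain b where b: "b \<in> A" "b \<noteq> a"
      using assms(1,2) a(1) by (metis One_nat_def Suc_1 card_2_iff' card_le_Suc0_iff_eq not_less_eq_eq)
    let ?w = "inf_image (mu v) (a ## sconst b)"
    have w: "?w = mu v [a] @- inf_image (mu v) (sconst b)"
      using inf_image_mu_unfold[of v "a ## sconst b" 1] by simp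
    have "a ## sconst b \<in> streams A"
      using a(1) b(1) by (simp add: streams_iff_sset)
    then have "quasiperiodic ?w"
      using sq unfolding strongly_quasiperiodic_def by blast
    moreover have "a \<in> sset ?w"
      unfolding w using set_mu(1)[of "[a]" v] by simp
    ultimately have "a \<in> sset (sdrop (length (mu v [a])) ?w)"
      by (rule quasiperiodic_recurrent)
    \<comment> \<open>Behind the block of \<open>a\<close> only letters of \<open>v\<close> and
      \<open>b\<close> remain.\<close>
    then have "a \<in> sset (inf_image (mu v) (sconst b))"
      unfolding w by (simp add: sdrop_shift)
    then show False
      using sset_inf_image_mu[of v "sconst b"] a(2) b(2) by auto
  qed
  ultimately show ?thesis
    using Pal by blast
qed

end
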